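(* For a fixed total field $u$, the operator $G:C^2([0,2\pi])\to C([0,2\pi])$, $G(z)=\nu(z)\cdot\nabla u(z)$, is Fréchet differentiable and its derivative is given by $$G'(z)h=\frac{1}{|z_\phi|}(I-\nu\nu^\top)h_\phi^\perp\cdot\nabla u+\nu\cdot(\nabla\nabla^\top u\,h),$$ where $I$ is the $2\times2$ identity matrix and $h_\phi^\perp=(\partial h^{(2)}/\partial\phi,\,-\partial h^{(1)}/\partial\phi)^\top$.
   Context: Total field: $D\subset\mathbb{R}^2$ is a bounded Lipschitz domain with connected complement $\mathbb{R}^2\setminus\overline D$ (a sound-hard obstacle), $k>0$ is a wavenumber, $u^i(x)=\mathrm{e}^{\mathrm{i}kx\cdot d}$ is an incident plane wave with direction $d$ in the unit circle, and $u=u^i+u^s$ is the total field, i.e. the solution of $\Delta u+k^2u=0$ in $\mathbb{R}^2\setminus\overline D$ with zero normal derivative on $\partial D$ and with the scattered field $u^s$ satisfying the Sommerfeld radiation condition $\lim_{r\to\infty}r^{1/2}(\partial u^s/\partial r-\mathrm{i}ku^s)=0$, $r=|x|$, uniformly in all directions. Curves: $\gamma=\{z(\phi):\phi\in[0,2\pi]\}$ is a closed curve in $\mathbb{R}^2$, the boundary of a bounded domain, with parameterization $z=(z^{(1)},z^{(2)})^\top$, and is identified with $z$. The shift is $h=(h^{(1)},h^{(2)})^\top$. The subscript $\phi$ denotes the derivative in $\phi$. The exterior normal vector is $\nu=z_\phi^\perp/|z_\phi^\perp|$ with $z_\phi^\perp=(\partial z^{(2)}/\partial\phi,\,-\partial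 z^{(1)}/\partial\phi)^\top$. Operator: for the fixed total field $u$, $G$ maps the boundary contour $\gamma$ onto the trace of $\partial u/\partial\nu$ on $\gamma$, that is, $G(z)=\nu(z)\cdot\nabla u(z)$. $\nabla\nabla^\top u$ is the Hessian matrix of $u$; in the formula for $G'(z)h$, $\nu$, $\nabla u$ and $\nabla\nabla^\top u$ are taken at $z$. *)

theory Defs
  imports "HOL-Analysis.Analysis"
begin

section \<open>Vector calculus for scalar fields on the plane\<close>

definition grad :: "(real^'n \<Rightarrow> 'b::real_normed_vector) \<Rightarrow> real^'n \<Rightarrow> 'b^'n" where
  "grad u x = (\<chi> i. frechet_derivative u (at x) (axis i 1))"

definition hessian :: "(real^'n \<Rightarrow> 'b::real_normed_vector) \<Rightarrow> real^'n \<Rightarrow> 'b^'n^'n" where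
  "hessian u x = (\<chi> i j. grad (\<lambda>y. grad u y $ i) x $ j)"

definition laplacian :: "(real^'n \<Rightarrow> 'b::real_normed_vector) \<Rightarrow> real^'n \<Rightarrow> 'b" where
  "laplacian u x = (\<Sum>i\<in>UNIV. hessian u x $ i $ i)"

text \<open>\<open>a \<bullet>\<^sub>c b\<close> is the dot product of a real vector with a complex one
  (bilinear, no conjugation).\<close>

definition rdot :: "real^'n \<Rightarrow> complex^'n \<Rightarrow> complex" (infixl \<open>\<bullet>\<^sub>c\<close> 70) where
  "a \<bullet>\<^sub>c b = (\<Sum>i\<in>UNIV. complex_of_real (a $ i) * b $ i)"

definition cvec :: "real^'n \<Rightarrow> complex^'n" where
  "cvec a = (\<chi> i. complex_of_real (a $ i))"

definition C2_on :: "(real^'n) set \<Rightarrow> (real^'n \<Rightarrow> 'b::real_normed_vector) \<Rightarrow> bool" where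
  "C2_on S u \<longleftrightarrow>
     (\<forall>x\<in>S. u differentiable (at x)) \<and>
     (\<forall>x\<in>S. \<forall>i. (\<lambda>y. grad u y $ i) differentiable (at x)) \<and>
     continuous_on S (hessian u)"


section \<open>The scattering problem\<close>

text \<open>Locally, after a rotation or reflection \<open>T\<close>, the domain is the subgraph of a
  Lipschitz function.\<close>

definition lipschitz_domain :: "(real^2) set \<Rightarrow> bool" where
  "lipschitz_domain D \<longleftrightarrow> open D \<and> connected D \<and> D \<noteq> {} \<and>
     (\<forall>p\<in>frontier D. \<exists>T r L (f :: real \<Rightarrow> real).
        orthogonal_transformation (T :: real^2 \<Rightarrow> real^2) \<and> r > 0 \<and> L-lipschitz_on UNIV f \<and>
        D \<inter> ball p r = {x \<in> ball p r. T x $ 2 < f (T x $ 1)})"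

definition plane_wave :: "real \<Rightarrow> real^2 \<Rightarrow> real^2 \<Rightarrow> complex" where
  "plane_wave k d x = exp (\<i> * complex_of_real (k * (x \<bullet> d)))"

definition sommerfeld :: "real \<Rightarrow> (real^2 \<Rightarrow> complex) \<Rightarrow> bool" where
  "sommerfeld k v \<longleftrightarrow>
     ((\<lambda>x. complex_of_real (sqrt (norm x)) *
            (((1 / norm x) *\<^sub>R x) \<bullet>\<^sub>c grad v x - \<i> * complex_of_real k * v x))
        \<longlongrightarrow> 0) at_infinity"

text \<open>\<open>H\<^sup>1\<close> regularity up to the boundary on bounded parts of the open set \<open>E\<close>, for a
  function that is classically differentiable in \<open>E\<close>.\<close>

definition H1_loc :: "(real^2) set \<Rightarrow> (real^2 \<Rightarrow> complex) \<Rightarrow> bool" where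
  "H1_loc E u \<longleftrightarrow>
     (\<forall>R. set_integrable lborel (E \<inter> ball 0 R) (\<lambda>x. (norm (u x))\<^sup>2) \<and>
          set_integrable lborel (E \<inter> ball 0 R) (\<lambda>x. (norm (grad u x))\<^sup>2))"

text \<open>On a Lipschitz boundary the normal derivative is the functional given by Green's first
  identity, \<open>\<langle>\<partial>u/\<partial>\<nu>, v\<rangle> = \<plusminus> \<integral>\<^sub>E (\<nabla>v \<cdot> \<nabla>u + v \<Delta>u)\<close>; it vanishes iff it vanishes on the
  restrictions of compactly supported \<open>C\<^sup>1\<close> functions \<open>v\<close>.\<close>

definition zero_normal_derivative :: "(real^2) set \<Rightarrow> (real^2 \<Rightarrow> complex) \<Rightarrow> bool" where
  "zero_normal_derivative E u \<longleftrightarrow>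
     (\<forall>v :: real^2 \<Rightarrow> real.
        (\<forall>x. v differentiable (at x)) \<and> continuous_on UNIV (grad v) \<and>
        (\<exists>R. \<forall>x. norm x > R \<longrightarrow> v x = 0) \<longrightarrow>
        set_lebesgue_integral lborel E
          (\<lambda>x. grad v x \<bullet>\<^sub>c grad u x + complex_of_real (v x) * laplacian u x) = 0)"

definition total_field :: "(real^2) set \<Rightarrow> real \<Rightarrow> real^2 \<Rightarrow> (real^2 \<Rightarrow> complex) \<Rightarrow> bool" where
  "total_field D k d u \<longleftrightarrow>
     (let E = - closure D in
        C2_on E u \<and>
        (\<forall>x\<in>E. laplacian u x + (complex_of_real k)\<^sup>2 * u x = 0) \<and>
        H1_loc E u \<and> zero_normal_derivative E u \<and>
        sommerfeld k (\<lambda>x. u x - plane_wave k d x))"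


section \<open>The space of twice continuously differentiable functions on \<open>[0, 2\<pi>]\<close>\<close>

abbreviation param_interval :: "real set" (\<open>\<I>\<close>) where
  "\<I> \<equiv> {0..2*pi}"

definition pderiv_I :: "(real \<Rightarrow> 'a::real_normed_vector) \<Rightarrow> real \<Rightarrow> 'a" where
  "pderiv_I f t = vector_derivative f (at t within \<I>)"

definition C2I :: "(real \<Rightarrow> 'a::real_normed_vector) set" where
  "C2I = {f. (\<forall>t\<in>\<I>. f differentiable (at t within \<I>)) \<and>
             (\<forall>t\<in>\<I>. pderiv_I f differentiable (at t within \<I>)) \<and>
             continuous_on \<I> (pderiv_I (pderiv_I f))}"

lemma pderiv_I_eq:
  assumes "(f has_vector_derivative D) (at t within \<I>)" "t \<in> \<I>"
  shows "pderiv_I f t = D"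
proof -
  have "at t within \<I> \<noteq> bot"
    using assms(2) pi_gt_zero by (simp add: trivial_limit_within islimpt_Icc)
  then show ?thesis
    unfolding pderiv_I_def using assms(1) by (rule vector_derivative_within)
qed

lemma pderiv_I_works:
  assumes "f differentiable (at t within \<I>)"
  shows "(f has_vector_derivative pderiv_I f t) (at t within \<I>)"
  using assms unfolding pderiv_I_def by (simp add: vector_derivative_works)

lemma has_pderiv_I_cong:
  assumes "\<And>s. s \<in> \<I> \<Longrightarrow> f s = g s" "t \<in> \<I>"
  shows "(f has_vector_derivative D) (at t within \<I>) \<longleftrightarrow> (g has_vector_derivative D) (at t within \<I>)"
  using assms by (intro has_vector_derivative_cong_ev) (auto intro: eventually_at_topological[THEN iffD2])

lemma C2I_iff:
  "f \<in> C2I \<longleftrightarrow> (\<exists>f' f''. (\<forall>t\<in>\<I>. (f has_vector_derivative f' t) (at t within \<I>)) \<and>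
      (\<forall>t\<in>\<I>. (f' has_vector_derivative f'' t) (at t within \<I>)) \<and> continuous_on \<I> f'')"
proof
  assume "f \<in> C2I"
  then show "\<exists>f' f''. (\<forall>t\<in>\<I>. (f has_vector_derivative f' t) (at t within \<I>)) \<and>
      (\<forall>t\<in>\<I>. (f' has_vector_derivative f'' t) (at t within \<I>)) \<and> continuous_on \<I> f''"
    unfolding C2I_def
    by (intro exI[of _ "pderiv_I f"] exI[of _ "pderiv_I (pderiv_I f)"]) (auto intro: pderiv_I_works)
next
  assume "\<exists>f' f''. (\<forall>t\<in>\<I>. (f has_vector_derivative f' t) (at t within \<I>)) \<and>
      (\<forall>t\<in>\<I>. (f' has_vector_derivative f'' t) (at t within \<I>)) \<and> continuous_on \<I> f''"
  then obtain f' f'' where f': "\<And>t. t \<in> \<I> \<Longrightarrow> (f has_vector_derivative f' t) (at t within \<I>)"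
    and f'': "\<And>t. t \<in> \<I> \<Longrightarrow> (f' has_vector_derivative f'' t) (at t within \<I>)"
    and c: "continuous_on \<I> f''" by blast
  have 1: "pderiv_I f t = f' t" if "t \<in> \<I>" for t
    using pderiv_I_eq f' that by blast
  have 2: "(pderiv_I f has_vector_derivative f'' t) (at t within \<I>)" if "t \<in> \<I>" for t
    using has_pderiv_I_cong[of "pderiv_I f" f' t] 1 f'' that by blast
  have 3: "pderiv_I (pderiv_I f) t = f'' t" if "t \<in> \<I>" for t
    using pderiv_I_eq 2 that by blast
  have "continuous_on \<I> (pderiv_I (pderiv_I f))"
    using c 3 by (metis (no_types, lifting) continuous_on_cong)
  then show "f \<in> C2I"
    unfolding C2I_def using differentiableI_vector[OF f'] differentiableI_vector[OF 2] by blast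
qed

lemma C2I_add_aux:
  assumes "f \<in> C2I" "g \<in> C2I"
  shows "(\<lambda>t. f t + g t) \<in> C2I"
    and "\<And>t. t \<in> \<I> \<Longrightarrow> pderiv_I (\<lambda>t. f t + g t) t = pderiv_I f t + pderiv_I g t"
    and "\<And>t. t \<in> \<I> \<Longrightarrow> pderiv_I (pderiv_I (\<lambda>t. f t + g t)) t
           = pderiv_I (pderiv_I f) t + pderiv_I (pderiv_I g) t"
proof -
  have f1: "(f has_vector_derivative pderiv_I f t) (at t within \<I>)"
    and f2: "(pderiv_I f has_vector_derivative pderiv_I (pderiv_I f) t) (at t within \<I>)"
    and g1: "(g has_vector_derivative pderiv_I g t) (at t within \<I>)"
    and g2: "(pderiv_I g has_vector_derivative pderiv_I (pderiv_I g) t) (at t within \<I>)"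
    if "t \<in> \<I>" for t using assms that pderiv_I_works unfolding C2I_def by blast+
  have s1: "((\<lambda>t. f t + g t) has_vector_derivative pderiv_I f t + pderiv_I g t) (at t within \<I>)"
    if "t \<in> \<I>" for t using f1 g1 that by (intro has_vector_derivative_add) auto
  have s2: "((\<lambda>t. pderiv_I f t + pderiv_I g t) has_vector_derivative
      pderiv_I (pderiv_I f) t + pderiv_I (pderiv_I g) t) (at t within \<I>)"
    if "t \<in> \<I>" for t using f2 g2 that by (intro has_vector_derivative_add) auto
  have "continuous_on \<I> (\<lambda>t. pderiv_I (pderiv_I f) t + pderiv_I (pderiv_I g) t)"
    using assms unfolding C2I_def by (auto intro: continuous_on_add)
  then show "(\<lambda>t. f t + g t) \<in> C2I"
    unfolding C2I_iff using s1 s2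
    by (intro exI conjI ballI) assumption+
  show 1: "pderiv_I (\<lambda>t. f t + g t) t = pderiv_I f t + pderiv_I g t" if "t \<in> \<I>" for t
    using pderiv_I_eq[OF s1] that by blast
  show "pderiv_I (pderiv_I (\<lambda>t. f t + g t)) t
      = pderiv_I (pderiv_I f) t + pderiv_I (pderiv_I g) t" if "t \<in> \<I>" for t
    using has_pderiv_I_cong[of "pderiv_I (\<lambda>t. f t + g t)", OF 1] s2 that
    by (intro pderiv_I_eq) auto
qed

lemma C2I_scaleR_aux:
  assumes "f \<in> C2I"
  shows "(\<lambda>t. c *\<^sub>R f t) \<in> C2I"
    and "\<And>t. t \<in> \<I> \<Longrightarrow> pderiv_I (\<lambda>t. c *\<^sub>R f t) t = c *\<^sub>R pderiv_I f t"
    and "\<And>t. t \<in> \<I> \<Longrightarrow> pderiv_I (pderiv_I (\<lambda>t. c *\<^sub>R f t)) t = c *\<^sub>R pderiv_I (pderiv_I f) t"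
proof -
  have f1: "(f has_vector_derivative pderiv_I f t) (at t within \<I>)"
    and f2: "(pderiv_I f has_vector_derivative pderiv_I (pderiv_I f) t) (at t within \<I>)"
    if "t \<in> \<I>" for t using assms that pderiv_I_works unfolding C2I_def by blast+
  have s1: "((\<lambda>t. c *\<^sub>R f t) has_vector_derivative c *\<^sub>R pderiv_I f t) (at t within \<I>)"
    if "t \<in> \<I>" for t
    by (rule bounded_linear.has_vector_derivative[OF bounded_linear_scaleR_right f1[OF that]])
  have s2: "((\<lambda>t. c *\<^sub>R pderiv_I f t) has_vector_derivative c *\<^sub>R pderiv_I (pderiv_I f) t)
      (at t within \<I>)" if "t \<in> \<I>" for t
    by (rule bounded_linear.has_vector_derivative[OF bounded_linear_scaleR_right f2[OF that]])
  have "continuous_on \<I> (\<lambda>t. c *\<^sub>R pderiv_I (pderiv_I f) t)"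
    using assms unfolding C2I_def by (auto intro!: continuous_intros)
  then show "(\<lambda>t. c *\<^sub>R f t) \<in> C2I"
    unfolding C2I_iff using s1 s2
    by (intro exI conjI ballI) assumption+
  show 1: "pderiv_I (\<lambda>t. c *\<^sub>R f t) t = c *\<^sub>R pderiv_I f t" if "t \<in> \<I>" for t
    using pderiv_I_eq[OF s1] that by blast
  show "pderiv_I (pderiv_I (\<lambda>t. c *\<^sub>R f t)) t = c *\<^sub>R pderiv_I (pderiv_I f) t" if "t \<in> \<I>" for t
    using has_pderiv_I_cong[of "pderiv_I (\<lambda>t. c *\<^sub>R f t)", OF 1] s2 that
    by (intro pderiv_I_eq) auto
qed

text \<open>Functions on \<open>[0, 2\<pi>]\<close> are represented by functions on the reals that vanish outside.
  All derivatives are taken within \<open>[0, 2\<pi>]\<close> and hence do not see the extension.\<close>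

typedef (overloaded) 'a C2_space = "{f :: real \<Rightarrow> 'a::real_normed_vector. f \<in> C2I \<and> (\<forall>t. t \<notin> \<I> \<longrightarrow> f t = 0)}"
  morphisms C2_fun Abs_C2_space
proof
  have "((\<lambda>t. 0::'a) has_vector_derivative 0) (at t within \<I>)" for t
    by (rule has_vector_derivative_const)
  then show "(\<lambda>t. 0) \<in> {f :: real \<Rightarrow> 'a. f \<in> C2I \<and> (\<forall>t. t \<notin> \<I> \<longrightarrow> f t = 0)}"
    by (auto simp: C2I_iff intro!: exI[of _ "\<lambda>t. 0"])
qed

setup_lifting type_definition_C2_space

definition sup_norm_I :: "(real \<Rightarrow> 'a::real_normed_vector) \<Rightarrow> real" where
  "sup_norm_I f = (SUP t\<in>\<I>. norm (f t))"

lemma I_nonempty: "\<I> \<noteq> {}"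
  using pi_gt_zero by simp

lemma norm_le_sup_norm_I:
  assumes "continuous_on \<I> f" "t \<in> \<I>"
  shows "norm (f t) \<le> sup_norm_I f"
proof -
  have "compact ((\<lambda>t. norm (f t)) ` \<I>)"
    using assms(1) by (intro compact_continuous_image continuous_intros) auto
  then have "bdd_above ((\<lambda>t. norm (f t)) ` \<I>)"
    by (simp add: bounded_imp_bdd_above compact_imp_bounded)
  then show ?thesis
    unfolding sup_norm_I_def by (rule cSUP_upper[OF assms(2)])
qed

lemma sup_norm_I_least:
  assumes "\<And>t. t \<in> \<I> \<Longrightarrow> norm (f t) \<le> b"
  shows "sup_norm_I f \<le> b"
  unfolding sup_norm_I_def using assms I_nonempty by (intro cSUP_least) auto

lemma sup_norm_I_cong:
  assumes "\<And>t. t \<in> \<I> \<Longrightarrow> f t = g t"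
  shows "sup_norm_I f = sup_norm_I g"
  unfolding sup_norm_I_def using assms by (intro SUP_cong) auto

lemma sup_norm_I_nonneg: "continuous_on \<I> f \<Longrightarrow> sup_norm_I f \<ge> 0"
  using norm_le_sup_norm_I[of f 0] norm_ge_zero[of "f 0"] pi_gt_zero by (simp del: norm_ge_zero)

lemma sup_norm_I_add:
  assumes "continuous_on \<I> f" "continuous_on \<I> g"
  shows "sup_norm_I (\<lambda>t. f t + g t) \<le> sup_norm_I f + sup_norm_I g"
  using assms by (intro sup_norm_I_least norm_triangle_le add_mono norm_le_sup_norm_I)

lemma sup_norm_I_scaleR_le:
  assumes "continuous_on \<I> f"
  shows "sup_norm_I (\<lambda>t. c *\<^sub>R f t) \<le> \<bar>c\<bar> * sup_norm_I f"
  using assms by (intro sup_norm_I_least) (simp add: mult_left_mono norm_le_sup_norm_I)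

lemma sup_norm_I_scaleR:
  assumes "continuous_on \<I> f"
  shows "sup_norm_I (\<lambda>t. c *\<^sub>R f t) = \<bar>c\<bar> * sup_norm_I f"
proof (cases "c = 0")
  case True
  then show ?thesis
    using sup_norm_I_scaleR_le[OF assms, of 0]
      sup_norm_I_nonneg[of "\<lambda>t. 0 *\<^sub>R f t"] by simp
next
  case False
  have "continuous_on \<I> (\<lambda>t. c *\<^sub>R f t)"
    using assms by (intro continuous_intros)
  from sup_norm_I_scaleR_le[OF this, of "1/c"]
  have "\<bar>c\<bar> * sup_norm_I f \<le> sup_norm_I (\<lambda>t. c *\<^sub>R f t)"
    using False by (simp add: field_simps)
  then show ?thesis
    using sup_norm_I_scaleR_le[OF assms, of c] by simp
qed

lemma C2I_continuous:
  assumes "f \<in> C2I"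
  shows "continuous_on \<I> f" "continuous_on \<I> (pderiv_I f)" "continuous_on \<I> (pderiv_I (pderiv_I f))"
  using assms unfolding C2I_def
  by (auto simp: continuous_on_eq_continuous_within intro: differentiable_imp_continuous_within)

lemma C2_fun_C2I: "C2_fun f \<in> C2I"
  using C2_fun[of f] by simp

lemma C2_fun_outside: "t \<notin> \<I> \<Longrightarrow> C2_fun f t = 0"
  using C2_fun[of f] by simp

lemma C2_fun_eqI: "(\<And>t. t \<in> \<I> \<Longrightarrow> C2_fun f t = C2_fun g t) \<Longrightarrow> f = g"
  by (metis C2_fun_inject C2_fun_outside ext)

instantiation C2_space :: (real_normed_vector) real_normed_vector
begin

lift_definition zero_C2_space :: "'a C2_space" is "\<lambda>t. 0"
  by (auto simp: C2I_iff intro!: exI[of _ "\<lambda>t. 0"])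

lift_definition plus_C2_space :: "'a C2_space \<Rightarrow> 'a C2_space \<Rightarrow> 'a C2_space" is "\<lambda>f g t. f t + g t"
  using C2I_add_aux(1) by auto

lift_definition scaleR_C2_space :: "real \<Rightarrow> 'a C2_space \<Rightarrow> 'a C2_space" is "\<lambda>c f t. c *\<^sub>R f t"
  using C2I_scaleR_aux(1) by auto

definition uminus_C2_space :: "'a C2_space \<Rightarrow> 'a C2_space" where
  "uminus_C2_space f = (-1) *\<^sub>R f"

definition minus_C2_space :: "'a C2_space \<Rightarrow> 'a C2_space \<Rightarrow> 'a C2_space" where
  "minus_C2_space f g = f + - g"

definition norm_C2_space :: "'a C2_space \<Rightarrow> real" where
  "norm_C2_space f = sup_norm_I (C2_fun f) + sup_norm_I (pderiv_I (C2_fun f))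
     + sup_norm_I (pderiv_I (pderiv_I (C2_fun f)))"

definition dist_C2_space :: "'a C2_space \<Rightarrow> 'a C2_space \<Rightarrow> real" where
  "dist_C2_space f g = norm (f - g)"

definition sgn_C2_space :: "'a C2_space \<Rightarrow> 'a C2_space" where
  "sgn_C2_space f = inverse (norm f) *\<^sub>R f"

definition uniformity_C2_space :: "('a C2_space \<times> 'a C2_space) filter" where
  "uniformity_C2_space = (INF e\<in>{0 <..}. principal {(x, y). dist x y < e})"

definition open_C2_space :: "'a C2_space set \<Rightarrow> bool" where
  "open_C2_space S = (\<forall>x\<in>S. \<forall>\<^sub>F (x', y) in uniformity. x' = x \<longrightarrow> y \<in> S)"

instance
proof
  fix f g h :: "'a C2_space" and a b :: real
  show "f + g + h = f + (g + h)" by transfer (simp add: add.assoc)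
  show "f + g = g + f" by transfer (simp add: add.commute)
  show "0 + f = f" by transfer simp
  show "- f + f = 0" unfolding uminus_C2_space_def by transfer simp
  show "f - g = f + - g" by (rule minus_C2_space_def)
  show "a *\<^sub>R (f + g) = a *\<^sub>R f + a *\<^sub>R g" by transfer (simp add: scaleR_add_right)
  show "(a + b) *\<^sub>R f = a *\<^sub>R f + b *\<^sub>R f" by transfer (simp add: scaleR_add_left)
  show "a *\<^sub>R b *\<^sub>R f = (a * b) *\<^sub>R f" by transfer simp
  show "1 *\<^sub>R f = f" by transfer simp
  show "dist f g = norm (f - g)" by (rule dist_C2_space_def)
  show "sgn f = inverse (norm f) *\<^sub>R f" by (rule sgn_C2_space_def)
  show "uniformity = (INF e\<in>{0 <..}. principal {(x, y :: 'a C2_space). dist x y < e})"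
    by (rule uniformity_C2_space_def)
  show "open U = (\<forall>x\<in>U. \<forall>\<^sub>F (x', y) in uniformity. x' = x \<longrightarrow> y \<in> U)" for U :: "'a C2_space set"
    by (rule open_C2_space_def)
  note cont = C2I_continuous[OF C2_fun_C2I]
  note nn = sup_norm_I_nonneg[OF cont(1)] sup_norm_I_nonneg[OF cont(2)]
    sup_norm_I_nonneg[OF cont(3)]
  show "norm f = 0 \<longleftrightarrow> f = 0"
  proof
    assume "norm f = 0"
    then have "sup_norm_I (C2_fun f) = 0"
      using nn[of f] unfolding norm_C2_space_def by linarith
    then have "C2_fun f t = C2_fun 0 t" if "t \<in> \<I>" for t
      using norm_le_sup_norm_I[OF cont(1)[of f] that] by (simp add: zero_C2_space.rep_eq)
    then show "f = 0" by (rule C2_fun_eqI)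
  next
    assume "f = 0"
    then have "f = 0 *\<^sub>R f" by transfer simp
    then have e: "C2_fun f = (\<lambda>t. 0 *\<^sub>R C2_fun f t)"
      by (metis scaleR_C2_space.rep_eq)
    have z: "C2_fun f t = 0" for t using fun_cong[OF e, of t] by simp
    have z1: "pderiv_I (C2_fun f) t = 0" if "t \<in> \<I>" for t
      using C2I_scaleR_aux(2)[OF C2_fun_C2I[of f] that, of 0] e by simp
    have z2: "pderiv_I (pderiv_I (C2_fun f)) t = 0" if "t \<in> \<I>" for t
      using C2I_scaleR_aux(3)[OF C2_fun_C2I[of f] that, of 0] e by simp
    have "sup_norm_I (C2_fun f) \<le> 0" "sup_norm_I (pderiv_I (C2_fun f)) \<le> 0"
      "sup_norm_I (pderiv_I (pderiv_I (C2_fun f))) \<le> 0"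
      by (intro sup_norm_I_least; simp add: z z1 z2)+
    then show "norm f = 0"
      using nn[of f] unfolding norm_C2_space_def by linarith
  qed
  have "sup_norm_I (C2_fun (f + g)) \<le> sup_norm_I (C2_fun f) + sup_norm_I (C2_fun g)"
    unfolding plus_C2_space.rep_eq by (intro sup_norm_I_add cont)
  moreover have "sup_norm_I (pderiv_I (C2_fun (f + g)))
      \<le> sup_norm_I (pderiv_I (C2_fun f)) + sup_norm_I (pderiv_I (C2_fun g))"
    using sup_norm_I_add[OF cont(2)[of f] cont(2)[of g]]
      sup_norm_I_cong[OF C2I_add_aux(2)[OF C2_fun_C2I[of f] C2_fun_C2I[of g]]]
    unfolding plus_C2_space.rep_eq by simp
  moreover have "sup_norm_I (pderiv_I (pderiv_I (C2_fun (f + g))))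
      \<le> sup_norm_I (pderiv_I (pderiv_I (C2_fun f))) + sup_norm_I (pderiv_I (pderiv_I (C2_fun g)))"
    using sup_norm_I_add[OF cont(3)[of f] cont(3)[of g]]
      sup_norm_I_cong[OF C2I_add_aux(3)[OF C2_fun_C2I[of f] C2_fun_C2I[of g]]]
    unfolding plus_C2_space.rep_eq by simp
  ultimately show "norm (f + g) \<le> norm f + norm g"
    unfolding norm_C2_space_def by linarith
  have "sup_norm_I (pderiv_I (C2_fun (a *\<^sub>R f))) = \<bar>a\<bar> * sup_norm_I (pderiv_I (C2_fun f))"
    using sup_norm_I_scaleR[OF cont(2)[of f], of a]
      sup_norm_I_cong[OF C2I_scaleR_aux(2)[OF C2_fun_C2I[of f]]]
    unfolding scaleR_C2_space.rep_eq by simp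
  moreover have "sup_norm_I (pderiv_I (pderiv_I (C2_fun (a *\<^sub>R f))))
      = \<bar>a\<bar> * sup_norm_I (pderiv_I (pderiv_I (C2_fun f)))"
    using sup_norm_I_scaleR[OF cont(3)[of f], of a]
      sup_norm_I_cong[OF C2I_scaleR_aux(3)[OF C2_fun_C2I[of f]]]
    unfolding scaleR_C2_space.rep_eq by simp
  moreover have "sup_norm_I (C2_fun (a *\<^sub>R f)) = \<bar>a\<bar> * sup_norm_I (C2_fun f)"
    unfolding scaleR_C2_space.rep_eq by (rule sup_norm_I_scaleR[OF cont(1)])
  ultimately show "norm (a *\<^sub>R f) = \<bar>a\<bar> * norm f"
    unfolding norm_C2_space_def by (simp add: algebra_simps)
qed

end


section \<open>Contours and the operator \<open>G\<close>\<close>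

abbreviation dphi :: "(real^2) C2_space \<Rightarrow> real \<Rightarrow> real^2" where
  "dphi z \<equiv> pderiv_I (C2_fun z)"

definition perp :: "real^2 \<Rightarrow> real^2" where
  "perp a = vector [a $ 2, - (a $ 1)]"

definition nu :: "(real^2) C2_space \<Rightarrow> real \<Rightarrow> real^2" where
  "nu z \<phi> = (1 / norm (perp (dphi z \<phi>))) *\<^sub>R perp (dphi z \<phi>)"

text \<open>Regular closed \<open>C\<^sup>2\<close> parameterizations, inside the open set \<open>E\<close>, of the boundary of a
  bounded domain \<open>\<Omega>\<close>, oriented such that \<open>nu z\<close> points out of \<open>\<Omega>\<close>.\<close>

definition contour_in :: "(real^2) set \<Rightarrow> (real^2) C2_space \<Rightarrow> bool" where
  "contour_in E z \<longleftrightarrow>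
     C2_fun z 0 = C2_fun z (2*pi) \<and>
     (\<forall>\<phi>\<in>\<I>. dphi z \<phi> \<noteq> 0) \<and>
     C2_fun z ` \<I> \<subseteq> E \<and>
     (\<exists>\<Omega>. open \<Omega> \<and> connected \<Omega> \<and> bounded \<Omega> \<and> \<Omega> \<noteq> {} \<and>
        frontier \<Omega> = C2_fun z ` \<I> \<and>
        (\<forall>\<phi>\<in>{0<..<2*pi}. \<forall>\<^sub>F t in at_right 0. C2_fun z \<phi> + t *\<^sub>R nu z \<phi> \<notin> closure \<Omega>))"

text \<open>The space \<open>C([0, 2\<pi>])\<close> is represented, isometrically, by the bounded continuous functions
  on the reals that are constant to the left and to the right of \<open>[0, 2\<pi>]\<close>. The abstraction
  \<open>Bcontfun\<close> is meaningful only if the function is continuous on \<open>[0, 2\<pi>]\<close>, which is the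
  case if \<open>z\<close> is regular and runs inside an open set where \<open>u\<close> is \<open>C\<^sup>2\<close>; these \<open>z\<close> form an open
  set.\<close>

definition G :: "(real^2 \<Rightarrow> complex) \<Rightarrow> (real^2) C2_space \<Rightarrow> (real \<Rightarrow>\<^sub>C complex)" where
  "G u z = Bcontfun (ext_cont (\<lambda>\<phi>. nu z \<phi> \<bullet>\<^sub>c grad u (C2_fun z \<phi>)) 0 (2*pi))"

definition outer :: "real^'n \<Rightarrow> real^'n \<Rightarrow> real^'n^'n" where
  "outer a b = (\<chi> i j. a $ i * b $ j)"

end

theory Submission
  imports Defs
begin

text \<open>
  The value \<open>G u z \<phi>\<close> depends on the contour only through the point \<open>z(\<phi>)\<close> and the velocity
  \<open>z\<^sub>\<phi>(\<phi>)\<close>: it is \<open>F (z(\<phi>), z\<^sub>\<phi>(\<phi>))\<close> for the function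
  \<open>F(x, p) = p\<^sup>\<bottom>/|p| \<cdot> \<nabla>u(x)\<close> of two plane vectors. So \<open>G u\<close> is a superposition operator, and the
  theorem is the chain rule for such operators.

  The function \<open>F\<close> is \<open>C\<^sup>1\<close> on the open set of all \<open>(x, p)\<close> where \<open>x\<close> lies outside the obstacle
  and \<open>p \<noteq> 0\<close>. Its derivative comes from the product rule: the differential of \<open>p\<^sup>\<bottom>/|p|\<close>
  takes \<open>q\<close> to \<open>1/|p|\<close> times the component of \<open>q\<^sup>\<bottom>\<close> orthogonal to \<open>\<nu>\<close>, and
  the differential of \<open>\<nabla>u\<close> is the Hessian (lemma \<open>has_derivative_normal_flux\<close>). The first order Taylor remainder of a \<open>C\<^sup>1\<close> function is
  \<open>o(|v|)\<close> uniformly on compact sets (lemma \<open>uniform_linearization_on_compact\<close>). The points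
  \<open>(z(\<phi>), z\<^sub>\<phi>(\<phi>))\<close> form a compact subset of the domain of \<open>F\<close>, and the increment
  \<open>(h(\<phi>), h\<^sub>\<phi>(\<phi>))\<close> is bounded, for every \<open>\<phi>\<close>, by the \<open>C\<^sup>2\<close> norm of \<open>h\<close>. Hence the pointwise
  linearization is a linearization in the supremum norm (lemma
  \<open>has_derivative_superposition\<close>).
\<close>

section \<open>Superposition operators into spaces of continuous functions\<close>

text \<open>The derivative is uniformly continuous on a compact neighbourhood of \<open>K\<close>, so the mean
  value inequality on small balls gives a remainder estimate with the same radius at every point
  of \<open>K\<close>.\<close>

lemma uniform_linearization_on_compact:
  fixes F :: "'a::euclidean_space \<Rightarrow> 'b::real_normed_vector" and F' :: "'a \<Rightarrow> 'a \<Rightarrow>\<^sub>L 'b"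
  assumes "compact K" "open W" "K \<subseteq> W"
    and deriv: "\<And>w. w \<in> W \<Longrightarrow> (F has_derivative blinfun_apply (F' w)) (at w)"
    and cont: "continuous_on W F'"
    and "e > 0"
  obtains r where "r > 0"
    "\<And>w v. w \<in> K \<Longrightarrow> norm v < r \<Longrightarrow>
       w + v \<in> W \<and> norm (F (w + v) - F w - F' w v) \<le> e * norm v"
proof -
  obtain \<delta> where "\<delta> > 0" and sub: "(\<Union>x\<in>K. cball x \<delta>) \<subseteq> W"
    using compact_subset_open_imp_cball_epsilon_subset[OF assms(1-3)] by blast
  define K' where "K' = {x + y |x y. x \<in> K \<and> y \<in> cball 0 \<delta>}"
  have K': "x + v \<in> K'" if "x \<in> K" "norm v \<le> \<delta>" for x v
    unfolding K'_def using that by auto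
  have "K' \<subseteq> W"
  proof
    fix y assume "y \<in> K'"
    then obtain x v where "y = x + v" "x \<in> K" "norm v \<le> \<delta>"
      unfolding K'_def by auto
    then show "y \<in> W"
      using sub by (force simp: dist_norm)
  qed
  have "compact K'"
    unfolding K'_def using \<open>compact K\<close> by (intro compact_sums) auto
  then have "uniformly_continuous_on K' F'"
    using cont \<open>K' \<subseteq> W\<close> by (meson compact_uniformly_continuous continuous_on_subset)
  then obtain \<eta> where "\<eta> > 0"
    and \<eta>: "\<And>x y. x \<in> K' \<Longrightarrow> y \<in> K' \<Longrightarrow> dist y x < \<eta> \<Longrightarrow> dist (F' y) (F' x) < e"
    using \<open>e > 0\<close> unfolding uniformly_continuous_on_def by metis
  define r where "r = min \<delta> \<eta>"
  have r: "r > 0" "r \<le> \<delta>" "r \<le> \<eta>"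
    using \<open>\<delta> > 0\<close> \<open>\<eta> > 0\<close> by (auto simp: r_def)
  have ball: "y \<in> K'" if "w \<in> K" "y \<in> ball w r" for w y
    using K'[OF that(1), of "y - w"] that(2) r by (simp add: dist_norm norm_minus_commute)
  have "w + v \<in> W \<and> norm (F (w + v) - F w - F' w v) \<le> e * norm v"
    if w: "w \<in> K" and v: "norm v < r" for w v
  proof
    show "w + v \<in> W"
      using K'[OF w] v r \<open>K' \<subseteq> W\<close> by auto
    have "norm (F (w + v) - F w - F' w (w + v - w)) \<le> norm (w + v - w) * e"
    proof (rule differentiable_bound_linearization[where S = "ball w r"])
      show "w + t *\<^sub>R (w + v - w) \<in> ball w r" if "t \<in> {0..1}" for t
      proof -
        have "\<bar>t\<bar> * norm v \<le> 1 * norm v"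
          using that by (intro mult_right_mono) auto
        then show ?thesis
          using v by (simp add: dist_norm)
      qed
      show "(F has_derivative F' x) (at x within ball w r)" if "x \<in> ball w r" for x
        using deriv ball[OF w that] \<open>K' \<subseteq> W\<close> by (blast intro: has_derivative_at_withinI)
      show "w \<in> ball w r"
        using r by simp
      show "onorm (blinfun_apply (F' x) - blinfun_apply (F' w)) \<le> e" if "x \<in> ball w r" for x
      proof -
        have "dist x w < \<eta>"
          using that r by (simp add: dist_commute)
        then have "dist (F' x) (F' w) < e"
          using ball[OF w] that r by (intro \<eta>) auto
        then show ?thesis
          by (simp add: dist_norm norm_blinfun.rep_eq minus_blinfun.rep_eq fun_diff_def)
      qed
    qed
    then show "norm (F (w + v) - F w - F' w v) \<le> e * norm v"
      by (simp add: mult.commute)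
  qed
  with \<open>r > 0\<close> show ?thesis
    using that by blast
qed

lemma apply_Bcontfun_ext_cont:
  fixes f :: "'a::euclidean_space \<Rightarrow> 'b::metric_space"
  assumes "continuous_on (cbox a b) f"
  shows "apply_bcontfun (Bcontfun (ext_cont f a b)) t = f (clamp a b t)"
proof -
  have "ext_cont f a b \<in> bcontfun"
    unfolding bcontfun_def ext_cont_def
    using clamp_continuous_on[OF assms]
      clamp_bounded[OF compact_imp_bounded[OF compact_continuous_image[OF assms compact_cbox]]]
    by blast
  then have "apply_bcontfun (Bcontfun (ext_cont f a b)) = ext_cont f a b"
    by (rule Bcontfun_inverse)
  then show ?thesis
    by (simp only: ext_cont_def)
qed

text \<open>The map \<open>J\<close> stands for the jet of a curve: the inner argument of the superposition, which
  depends on the curve linearly and is controlled pointwise by the norm of the curve.\<close>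

lemma has_derivative_superposition:
  fixes F :: "'a::euclidean_space \<Rightarrow> 'b::real_normed_vector" and F' :: "'a \<Rightarrow> 'a \<Rightarrow> 'b"
    and J :: "'x::real_normed_vector \<Rightarrow> real \<Rightarrow> 'a"
  assumes "a \<le> b" "open W"
    and deriv: "\<And>w. w \<in> W \<Longrightarrow> (F has_derivative F' w) (at w)"
    and cont: "\<And>v. continuous_on W (\<lambda>w. F' w v)"
    and J_cont: "\<And>x. continuous_on {a..b} (J x)"
    and J_add: "\<And>x y t. t \<in> {a..b} \<Longrightarrow> J (x + y) t = J x t + J y t"
    and J_scaleR: "\<And>c x t. t \<in> {a..b} \<Longrightarrow> J (c *\<^sub>R x) t = c *\<^sub>R J x t"
    and J_bound: "\<And>x t. t \<in> {a..b} \<Longrightarrow> norm (J x t) \<le> norm x"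
    and z: "\<And>t. t \<in> {a..b} \<Longrightarrow> J z t \<in> W"
  shows "((\<lambda>x. Bcontfun (ext_cont (\<lambda>t. F (J x t)) a b)) has_derivative
          (\<lambda>h. Bcontfun (ext_cont (\<lambda>t. F' (J z t) (J h t)) a b))) (at z)"
    and "\<And>t. t \<in> {a..b} \<Longrightarrow> apply_bcontfun (Bcontfun (ext_cont (\<lambda>t. F (J z t)) a b)) t = F (J z t)"
    and "\<And>h t. t \<in> {a..b} \<Longrightarrow>
          apply_bcontfun (Bcontfun (ext_cont (\<lambda>t. F' (J z t) (J h t)) a b)) t = F' (J z t) (J h t)"
proof -
  \<comment> \<open>As \<open>'a\<close> has finite dimension, continuity in each direction gives continuity in the
    operator norm; \<open>B w\<close> is meaningful only for \<open>w\<close> in \<open>W\<close>.\<close>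
  define B where "B w = Blinfun (F' w)" for w
  have B: "blinfun_apply (B w) = F' w" if "w \<in> W" for w
    unfolding B_def using has_derivative_bounded_linear[OF deriv[OF that]]
    by (rule bounded_linear_Blinfun_apply)
  have derivB: "(F has_derivative blinfun_apply (B w)) (at w)" if "w \<in> W" for w
    using deriv B that by simp
  have contB: "continuous_on W B"
  proof (rule continuous_on_blinfun_componentwise)
    fix i :: 'a
    show "continuous_on W (\<lambda>w. blinfun_apply (B w) i)"
      using cont[of i] by (rule continuous_on_eq) (simp add: B)
  qed
  have contF: "continuous_on W F"
    using derivB has_derivative_continuous continuous_at_imp_continuous_on by blast
  define K where "K = J z ` {a..b}"
  have "compact K"
    unfolding K_def by (intro compact_continuous_image J_cont) auto
  have "K \<subseteq> W"
    using z by (auto simp: K_def)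
  have clamp: "clamp a b t \<in> {a..b}" for t
    using clamp_in_interval[of a b t] \<open>a \<le> b\<close> by simp
  have app: "apply_bcontfun (Bcontfun (ext_cont (\<lambda>t. F (J x t)) a b)) t = F (J x (clamp a b t))"
    if "\<And>t. t \<in> {a..b} \<Longrightarrow> J x t \<in> W" for x t
  proof (rule apply_Bcontfun_ext_cont)
    show "continuous_on (cbox a b) (\<lambda>t. F (J x t))"
      using that J_cont[of x] by (auto intro!: continuous_on_compose2[OF contF])
  qed
  have app': "apply_bcontfun (Bcontfun (ext_cont (\<lambda>t. F' (J z t) (J h t)) a b)) t
      = blinfun_apply (B (J z (clamp a b t))) (J h (clamp a b t))" for h t
  proof -
    have "continuous_on {a..b} (\<lambda>t. B (J z t))"
      using z J_cont[of z] by (auto intro!: continuous_on_compose2[OF contB])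
    then have "continuous_on {a..b} (\<lambda>t. blinfun_apply (B (J z t)) (J h t))"
      by (intro continuous_intros J_cont)
    then have "continuous_on {a..b} (\<lambda>t. F' (J z t) (J h t))"
      by (rule continuous_on_eq) (simp add: B z)
    then show ?thesis
      by (subst apply_Bcontfun_ext_cont) (simp_all add: B z[OF clamp])
  qed
  show "apply_bcontfun (Bcontfun (ext_cont (\<lambda>t. F (J z t)) a b)) t = F (J z t)"
    if "t \<in> {a..b}" for t
    using that app[of z t, OF z] by simp
  show "apply_bcontfun (Bcontfun (ext_cont (\<lambda>t. F' (J z t) (J h t)) a b)) t = F' (J z t) (J h t)"
    if "t \<in> {a..b}" for h t
    using that by (simp add: app' B z)
  let ?N = "\<lambda>x. Bcontfun (ext_cont (\<lambda>t. F (J x t)) a b)"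
  let ?N' = "\<lambda>h. Bcontfun (ext_cont (\<lambda>t. F' (J z t) (J h t)) a b)"
  have lin: "bounded_linear ?N'"
  proof -
    have "compact (B ` K)"
      using \<open>compact K\<close> \<open>K \<subseteq> W\<close> contB
      by (intro compact_continuous_image) (auto intro: continuous_on_subset)
    then obtain M where "M > 0" and M: "\<And>w. w \<in> K \<Longrightarrow> norm (B w) \<le> M"
      by (metis bounded_pos compact_imp_bounded imageI)
    show ?thesis
    proof (rule bounded_linear_intro)
      fix x y c
      show "?N' (x + y) = ?N' x + ?N' y"
        by (rule bcontfun_eqI) (simp add: app' J_add[OF clamp] blinfun.add_right)
      show "?N' (c *\<^sub>R x) = c *\<^sub>R ?N' x"
        by (rule bcontfun_eqI) (simp add: app' J_scaleR[OF clamp] blinfun.scaleR_right)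
      show "norm (?N' x) \<le> norm x * M"
      proof (rule norm_bound)
        fix t
        let ?s = "clamp a b t"
        have "norm (B (J z ?s) (J x ?s)) \<le> norm (B (J z ?s)) * norm (J x ?s)"
          by (rule norm_blinfun)
        also have "\<dots> \<le> M * norm x"
          using M[of "J z ?s"] clamp J_bound \<open>M > 0\<close> by (intro mult_mono) (auto simp: K_def)
        finally show "norm (apply_bcontfun (?N' x) t) \<le> norm x * M"
          by (simp add: app' mult.commute)
      qed
    qed
  qed
  have "\<exists>r>0. \<forall>y. norm (y - z) < r \<longrightarrow>
      norm (?N y - ?N z - ?N' (y - z)) \<le> e * norm (y - z)" if "e > 0" for e
  proof -
    obtain r where "r > 0" and r: "\<And>w v. w \<in> K \<Longrightarrow> norm v < r \<Longrightarrow>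
        w + v \<in> W \<and> norm (F (w + v) - F w - B w v) \<le> e * norm v"
      using uniform_linearization_on_compact[OF \<open>compact K\<close> \<open>open W\<close> \<open>K \<subseteq> W\<close> derivB contB
          \<open>e > 0\<close>] by metis
    have "norm (?N y - ?N z - ?N' (y - z)) \<le> e * norm (y - z)" if y: "norm (y - z) < r" for y
    proof -
      have split: "J y t = J z t + J (y - z) t" if "t \<in> {a..b}" for t
        using J_add[OF that, of z "y - z"] by simp
      have small: "norm (J (y - z) t) < r" if "t \<in> {a..b}" for t
        using J_bound[OF that, of "y - z"] y by simp
      have rem: "J y t \<in> W \<and> norm (F (J y t) - F (J z t) - B (J z t) (J (y - z) t))
          \<le> e * norm (J (y - z) t)" if "t \<in> {a..b}" for t
        using r[OF _ small[OF that], of "J z t"] that split[OF that] by (simp add: K_def)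
      show ?thesis
      proof (rule norm_bound)
        fix t
        let ?s = "clamp a b t"
        have "norm (F (J y ?s) - F (J z ?s) - B (J z ?s) (J (y - z) ?s))
            \<le> e * norm (J (y - z) ?s)"
          using rem clamp by blast
        also have "\<dots> \<le> e * norm (y - z)"
          using J_bound clamp \<open>e > 0\<close> by (intro mult_left_mono) auto
        finally show "norm (apply_bcontfun (?N y - ?N z - ?N' (y - z)) t) \<le> e * norm (y - z)"
          using app[of y t] app[of z t] rem z by (simp del: atLeastAtMost_iff add: app')
      qed
    qed
    with \<open>r > 0\<close> show ?thesis
      by blast
  qed
  then show "(?N has_derivative ?N') (at z)"
    unfolding has_derivative_at_alt using lin by blast
qed

section \<open>The normal derivative as a function of point and velocity\<close>

lemma bounded_bilinear_rdot: "bounded_bilinear ((\<bullet>\<^sub>c) :: real^'n \<Rightarrow> complex^'n \<Rightarrow> complex)"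
proof
  fix a a' :: "real^'n" and b b' :: "complex^'n" and r :: real
  show "(a + a') \<bullet>\<^sub>c b = a \<bullet>\<^sub>c b + a' \<bullet>\<^sub>c b" "a \<bullet>\<^sub>c (b + b') = a \<bullet>\<^sub>c b + a \<bullet>\<^sub>c b'"
    by (simp_all add: rdot_def algebra_simps sum.distrib)
  show "(r *\<^sub>R a) \<bullet>\<^sub>c b = r *\<^sub>R (a \<bullet>\<^sub>c b)" "a \<bullet>\<^sub>c (r *\<^sub>R b) = r *\<^sub>R (a \<bullet>\<^sub>c b)"
    by (simp_all add: rdot_def scaleR_sum_right, simp_all add: scaleR_conv_of_real algebra_simps)
  show "\<exists>K. \<forall>a b. norm (a \<bullet>\<^sub>c b :: complex) \<le> norm (a :: real^'n) * norm (b :: complex^'n) * K"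
  proof (intro exI allI)
    fix a :: "real^'n" and b :: "complex^'n"
    have "norm (a \<bullet>\<^sub>c b) \<le> (\<Sum>i\<in>(UNIV::'n set). norm a * norm b)"
      unfolding rdot_def
      by (intro sum_norm_le)
        (simp add: norm_mult mult_mono component_le_norm_cart
          Finite_Cartesian_Product.norm_nth_le)
    then show "norm (a \<bullet>\<^sub>c b) \<le> norm a * norm b * real CARD('n)"
      by (simp add: mult.commute)
  qed
qed

lemmas has_derivative_rdot = bounded_bilinear.FDERIV[OF bounded_bilinear_rdot]
lemmas continuous_on_rdot = bounded_bilinear.continuous_on[OF bounded_bilinear_rdot]

lemma has_derivative_vecI:
  fixes f :: "'a::real_normed_vector \<Rightarrow> 'b::euclidean_space^'n"
  assumes "\<And>i. ((\<lambda>x. f x $ i) has_derivative (\<lambda>v. f' v $ i)) (at x within S)"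
  shows "(f has_derivative f') (at x within S)"
proof (rule has_derivative_componentwise_within[THEN iffD2], rule ballI)
  fix e :: "'b^'n"
  assume "e \<in> Basis"
  then obtain i c where "e = axis i c"
    by (auto simp: Basis_vec_def)
  then show "((\<lambda>x. f x \<bullet> e) has_derivative (\<lambda>v. f' v \<bullet> e)) (at x within S)"
    using has_derivative_inner_left[OF assms[of i]] by (simp add: inner_axis)
qed

text \<open>The rows of the Hessian are the partial derivatives of the components of the gradient, and
  these components are differentiable, so their partial derivatives determine the differential.\<close>

lemma has_derivative_grad:
  fixes u :: "real^'n \<Rightarrow> complex"
  assumes "C2_on S u" "x \<in> S"
  shows "(grad u has_derivative (\<lambda>v. hessian u x *v cvec v)) (at x)"
proof (rule has_derivative_vecI)
  fix i
  let ?D = "frechet_derivative (\<lambda>y. grad u y $ i) (at x)"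
  have d: "(\<lambda>y. grad u y $ i) differentiable (at x)"
    using assms by (auto simp: C2_on_def)
  note lin = linear_frechet_derivative[OF d]
  have "?D v = (hessian u x *v cvec v) $ i" for v
  proof -
    have "v = (\<Sum>j\<in>UNIV. (v $ j) *\<^sub>R axis j 1)"
      by (rule basis_expansion[of v, unfolded scalar_mult_eq_scaleR, symmetric])
    then have "?D v = ?D (\<Sum>j\<in>UNIV. (v $ j) *\<^sub>R axis j 1)"
      by (rule arg_cong)
    also have "\<dots> = (\<Sum>j\<in>UNIV. (v $ j) *\<^sub>R ?D (axis j 1))"
      by (simp only: linear_sum[OF lin] linear_cmul[OF lin])
    also have "\<dots> = (hessian u x *v cvec v) $ i"
      by (simp add: matrix_vector_mult_def hessian_def grad_def cvec_def scaleR_conv_of_real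
          mult.commute)
    finally show ?thesis .
  qed
  then have "?D = (\<lambda>v. (hessian u x *v cvec v) $ i)"
    by (rule ext)
  then show "((\<lambda>y. grad u y $ i) has_derivative (\<lambda>v. (hessian u x *v cvec v) $ i)) (at x)"
    using d[unfolded frechet_derivative_works] by simp
qed

lemma linear_perp: "linear perp"
  by (rule linearI) (simp_all add: perp_def vec_eq_iff forall_2)

lemmas bounded_linear_perp = linear_conv_bounded_linear[THEN iffD1, OF linear_perp]

lemma norm_perp: "norm (perp a) = norm a"
  by (simp add: perp_def norm_vec_def L2_set_def sum_2 add.commute)

lemma perp_eq_0_iff: "perp a = 0 \<longleftrightarrow> a = 0"
  by (metis norm_perp norm_eq_zero)

lemma outer_mult_vec: "outer a b *v v = (b \<bullet> v) *\<^sub>R a"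
  by (simp add: outer_def matrix_vector_mult_def inner_vec_def vec_eq_iff sum_distrib_left
      sum_distrib_right algebra_simps)

definition unit_normal :: "real^2 \<Rightarrow> real^2" where
  "unit_normal p = (1 / norm (perp p)) *\<^sub>R perp p"

lemma nu_eq_unit_normal: "nu z \<phi> = unit_normal (dphi z \<phi>)"
  by (simp add: nu_def unit_normal_def)

lemma proj_mult_vec: "(mat 1 - outer n n) *v v = v - (n \<bullet> v) *\<^sub>R n"
  by (simp add: matrix_vector_mult_diff_rdistrib outer_mult_vec)

text \<open>Normalization removes the radial part of a variation, so only the part of \<open>q\<^sup>\<bottom>\<close>
  orthogonal to the normal contributes.\<close>

lemma has_derivative_unit_normal:
  assumes "p \<noteq> 0"
  shows "(unit_normal has_derivative
    (\<lambda>q. (1 / norm p) *\<^sub>R ((mat 1 - outer (unit_normal p) (unit_normal p)) *v perp q))) (at p)"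
proof -
  have perp: "(perp has_derivative perp) (at p)"
    by (rule bounded_linear_imp_has_derivative[OF bounded_linear_perp])
  have "perp p \<noteq> 0"
    using assms by (simp add: perp_eq_0_iff)
  then have norm: "((\<lambda>p. norm (perp p)) has_derivative (\<lambda>q. perp q \<bullet> sgn (perp p))) (at p)"
    using has_derivative_compose[OF perp has_derivative_norm] by blast
  have inv: "((\<lambda>p. inverse (norm (perp p))) has_derivative
      (\<lambda>q. - (inverse (norm p) * (perp q \<bullet> sgn (perp p)) * inverse (norm p)))) (at p)"
    using Deriv.has_derivative_inverse[OF _ norm] assms by (simp add: norm_perp)
  have "((\<lambda>p. inverse (norm (perp p)) *\<^sub>R perp p) has_derivative
    (\<lambda>q. (1 / norm p) *\<^sub>R ((mat 1 - outer (unit_normal p) (unit_normal p)) *v perp q))) (at p)"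
  proof (rule has_derivative_eq_rhs[OF has_derivative_scaleR[OF inv perp]], rule ext)
    fix q
    have "(1 / norm p) *\<^sub>R ((mat 1 - outer (unit_normal p) (unit_normal p)) *v perp q)
        = inverse (norm p) *\<^sub>R perp q
          + (- (inverse (norm p) * (perp q \<bullet> sgn (perp p)) * inverse (norm p))) *\<^sub>R perp p"
      by (simp add: proj_mult_vec unit_normal_def norm_perp sgn_div_norm inner_commute[of "perp p"]
          scaleR_diff_right divide_inverse)
    then show "inverse (norm (perp p)) *\<^sub>R perp q
          + (- (inverse (norm p) * (perp q \<bullet> sgn (perp p)) * inverse (norm p))) *\<^sub>R perp p
        = (1 / norm p) *\<^sub>R ((mat 1 - outer (unit_normal p) (unit_normal p)) *v perp q)"
      by (simp only: norm_perp)
  qed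
  then show ?thesis
    by (simp add: unit_normal_def[abs_def] divide_inverse)
qed

text \<open>The product rule for the dot product: varying the velocity turns the normal, varying the point
  moves the place where the gradient is taken. Here \<open>w\<close> is the pair of point and velocity, and
  \<open>v\<close> is the pair of their variations.\<close>

lemma has_derivative_normal_flux:
  fixes u :: "real^2 \<Rightarrow> complex"
  assumes "C2_on E u" "fst w \<in> E" "snd w \<noteq> 0"
  shows "((\<lambda>w. unit_normal (snd w) \<bullet>\<^sub>c grad u (fst w)) has_derivative
    (\<lambda>v. ((1 / norm (snd w)) *\<^sub>R
            ((mat 1 - outer (unit_normal (snd w)) (unit_normal (snd w))) *v perp (snd v)))
              \<bullet>\<^sub>c grad u (fst w)
         + unit_normal (snd w) \<bullet>\<^sub>c (hessian u (fst w) *v cvec (fst v)))) (at w)"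
proof -
  have grad: "((\<lambda>w. grad u (fst w)) has_derivative (\<lambda>v. hessian u (fst w) *v cvec (fst v))) (at w)"
    using has_derivative_compose[OF has_derivative_fst[OF has_derivative_ident]
        has_derivative_grad[OF assms(1,2)]] .
  have normal: "((\<lambda>w. unit_normal (snd w)) has_derivative (\<lambda>v. (1 / norm (snd w)) *\<^sub>R
      ((mat 1 - outer (unit_normal (snd w)) (unit_normal (snd w))) *v perp (snd v)))) (at w)"
    using has_derivative_compose[OF has_derivative_snd[OF has_derivative_ident]
        has_derivative_unit_normal[OF assms(3)]] .
  show ?thesis
    using has_derivative_rdot[OF normal grad] by (simp only: add.commute)
qed

lemma continuous_on_normal_flux_derivative:
  fixes u :: "real^2 \<Rightarrow> complex"
  assumes "C2_on E u"
  shows "continuous_on (E \<times> - {0})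
    (\<lambda>w. ((1 / norm (snd w)) *\<^sub>R
            ((mat 1 - outer (unit_normal (snd w)) (unit_normal (snd w))) *v perp (snd v)))
              \<bullet>\<^sub>c grad u (fst w)
         + unit_normal (snd w) \<bullet>\<^sub>c (hessian u (fst w) *v cvec (fst v)))"
proof -
  let ?W = "E \<times> - {0 :: real^2}"
  have "continuous_on E (grad u)"
    by (intro continuous_at_imp_continuous_on ballI)
      (rule has_derivative_continuous[OF has_derivative_grad[OF assms]])
  then have grad: "continuous_on ?W (\<lambda>w. grad u (fst w))"
    by (rule continuous_on_compose2[OF _ continuous_on_fst[OF continuous_on_id]]) auto
  have "continuous_on E (hessian u)"
    using assms by (simp add: C2_on_def)
  then have hess: "continuous_on ?W (\<lambda>w. hessian u (fst w))"
    by (rule continuous_on_compose2[OF _ continuous_on_fst[OF continuous_on_id]]) auto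
  have "continuous_on (- {0}) unit_normal"
    by (intro continuous_at_imp_continuous_on ballI)
      (rule has_derivative_continuous[OF has_derivative_unit_normal], simp)
  then have normal: "continuous_on ?W (\<lambda>w. unit_normal (snd w))"
    by (rule continuous_on_compose2[OF _ continuous_on_snd[OF continuous_on_id]]) auto
  have "continuous_on ?W (\<lambda>w. (1 / norm (snd w)) *\<^sub>R
      (perp (snd v) - (unit_normal (snd w) \<bullet> perp (snd v)) *\<^sub>R unit_normal (snd w)))"
    by (intro continuous_on_scaleR continuous_on_divide continuous_on_norm continuous_on_diff
        continuous_on_inner continuous_on_snd continuous_on_id continuous_on_const normal) auto
  moreover have "continuous_on ?W (\<lambda>w. hessian u (fst w) *v cvec (fst v))"
    unfolding matrix_vector_mult_def
    by (intro continuous_on_vec_lambda continuous_on_sum continuous_on_mult continuous_on_component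
        continuous_on_const hess)
  ultimately show ?thesis
    unfolding proj_mult_vec by (intro continuous_on_add continuous_on_rdot grad normal)
qed

section \<open>The jet of a parameterization\<close>

definition jet :: "(real^2) C2_space \<Rightarrow> real \<Rightarrow> (real^2) \<times> (real^2)" where
  "jet z \<phi> = (C2_fun z \<phi>, dphi z \<phi>)"

lemma continuous_on_jet: "continuous_on \<I> (jet z)"
  unfolding jet_def by (intro continuous_on_Pair C2I_continuous C2_fun_C2I)

lemma jet_add: "\<phi> \<in> \<I> \<Longrightarrow> jet (x + y) \<phi> = jet x \<phi> + jet y \<phi>"
  using C2I_add_aux(2)[OF C2_fun_C2I C2_fun_C2I] by (simp add: jet_def plus_C2_space.rep_eq)

lemma jet_scaleR: "\<phi> \<in> \<I> \<Longrightarrow> jet (c *\<^sub>R x) \<phi> = c *\<^sub>R jet x \<phi>"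
  using C2I_scaleR_aux(2)[OF C2_fun_C2I] by (simp add: jet_def scaleR_C2_space.rep_eq)

lemma norm_jet_le:
  assumes "\<phi> \<in> \<I>"
  shows "norm (jet x \<phi>) \<le> norm x"
proof -
  note cont = C2I_continuous[OF C2_fun_C2I[of x]]
  have "norm (jet x \<phi>) \<le> norm (C2_fun x \<phi>) + norm (dphi x \<phi>)"
    unfolding jet_def by (rule norm_Pair_le)
  also have "\<dots> \<le> sup_norm_I (C2_fun x) + sup_norm_I (dphi x)"
    using assms cont by (intro add_mono norm_le_sup_norm_I)
  also have "\<dots> \<le> norm x"
    using sup_norm_I_nonneg[OF cont(3)] by (simp add: norm_C2_space_def)
  finally show ?thesis .
qed

section \<open>Differentiability of the normal derivative on the contour\<close>

theorem theorem3p1: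
  fixes D :: "(real^2) set" and k :: real and d :: "real^2"
    and u :: "real^2 \<Rightarrow> complex" and z :: "(real^2) C2_space"
  assumes "bounded D" and "lipschitz_domain D" and "connected (- closure D)"
    and "k > 0" and "norm d = 1"
    and "total_field D k d u"
    and "contour_in (- closure D) z"
  shows "(\<forall>\<phi>\<in>\<I>. apply_bcontfun (G u z) \<phi> = nu z \<phi> \<bullet>\<^sub>c grad u (C2_fun z \<phi>)) \<and>
    (\<exists>G'. (G u has_derivative G') (at z) \<and>
      (\<forall>h. \<forall>\<phi>\<in>\<I>. apply_bcontfun (G' h) \<phi> =
        ((1 / norm (dphi z \<phi>)) *\<^sub>R ((mat 1 - outer (nu z \<phi>) (nu z \<phi>)) *v perp (dphi h \<phi>)))
            \<bullet>\<^sub>c grad u (C2_fun z \<phi>)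
        + nu z \<phi> \<bullet>\<^sub>c (hessian u (C2_fun z \<phi>) *v cvec (C2_fun h \<phi>))))"
proof -
  let ?E = "- closure D"
  let ?W = "?E \<times> - {0 :: real^2}"
  define F where "F w = unit_normal (snd w) \<bullet>\<^sub>c grad u (fst w)" for w
  define F' where "F' w v = ((1 / norm (snd w)) *\<^sub>R
      ((mat 1 - outer (unit_normal (snd w)) (unit_normal (snd w))) *v perp (snd v)))
        \<bullet>\<^sub>c grad u (fst w)
      + unit_normal (snd w) \<bullet>\<^sub>c (hessian u (fst w) *v cvec (fst v))" for w v
  have C2: "C2_on ?E u"
    using assms(6) by (simp add: total_field_def Let_def)
  have "open ?W"
    by (intro open_Times) auto
  have F_deriv: "(F has_derivative F' w) (at w)" if "w \<in> ?W" for w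
    unfolding F_def[abs_def] F'_def[abs_def]
    using that by (intro has_derivative_normal_flux[OF C2]) auto
  have F'_cont: "continuous_on ?W (\<lambda>w. F' w v)" for v
    unfolding F'_def by (rule continuous_on_normal_flux_derivative[OF C2])
  have jet_z: "jet z \<phi> \<in> ?W" if "\<phi> \<in> \<I>" for \<phi>
    using assms(7) that unfolding contour_in_def jet_def by blast
  have G_eq: "G u = (\<lambda>x. Bcontfun (ext_cont (\<lambda>\<phi>. F (jet x \<phi>)) 0 (2 * pi)))"
    by (rule ext) (simp add: G_def F_def jet_def nu_eq_unit_normal)
  have "0 \<le> 2 * pi"
    by simp
  note superposition = has_derivative_superposition[OF this \<open>open ?W\<close> F_deriv F'_cont
      continuous_on_jet jet_add jet_scaleR norm_jet_le jet_z]
  show ?thesis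
  proof (intro conjI exI allI ballI)
    show "(G u has_derivative
        (\<lambda>h. Bcontfun (ext_cont (\<lambda>\<phi>. F' (jet z \<phi>) (jet h \<phi>)) 0 (2 * pi)))) (at z)"
      unfolding G_eq by (rule superposition(1))
  next
    fix \<phi> assume "\<phi> \<in> \<I>"
    then show "apply_bcontfun (G u z) \<phi> = nu z \<phi> \<bullet>\<^sub>c grad u (C2_fun z \<phi>)"
      using superposition(2) by (simp add: G_eq) (simp add: F_def jet_def nu_eq_unit_normal)
  next
    fix h \<phi> assume "\<phi> \<in> \<I>"
    then show "apply_bcontfun (Bcontfun (ext_cont (\<lambda>\<phi>. F' (jet z \<phi>) (jet h \<phi>)) 0 (2 * pi))) \<phi> =
        ((1 / norm (dphi z \<phi>)) *\<^sub>R ((mat 1 - outer (nu z \<phi>) (nu z \<phi>)) *v perp (dphi h \<phi>)))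
            \<bullet>\<^sub>c grad u (C2_fun z \<phi>)
        + nu z \<phi> \<bullet>\<^sub>c (hessian u (C2_fun z \<phi>) *v cvec (C2_fun h \<phi>))"
      using superposition(3) by simp (simp add: F'_def jet_def nu_eq_unit_normal)
  qed
qed

end
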